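(* Let $d\ge2$. There exist a (one-sided) shift of finite type $X$ and $m\in\mathbb{N}$ such that the hom tree-shifts $\mathcal{T}_X$ and $\mathcal{T}_{X^{[m]}}$ on the $d$-tree are not topologically conjugate, where $X^{[m]}$ is the $m$th higher block shift of $X$.
   Context: $\mathbb{N}=\{1,2,\dots\}$. A shift space over a finite alphabet $\mathcal{A}$ is a set $X\subseteq\mathcal{A}^{\mathbb{N}}$ consisting of all sequences that avoid every word from some set $\mathcal{F}$ of finite words over $\mathcal{A}$; it is a shift of finite type (SFT) if $\mathcal{F}$ can be taken finite. $\mathcal{A}(X)$ denotes the alphabet of $X$. For $n\in\mathbb{N}$, the $n$th higher block shift of $X$ is $$X^{[n]}=\{(y_i)_{i\in\mathbb{N}}\in(\mathcal{A}(X)^n)^{\mathbb{N}}:\ \exists x\in X \text{ such that } y_i=x_i x_{i+1}\cdots x_{i+n-1}\ \forall i\in\mathbb{N}\}.$$ Let $\Sigma=\{0,1,\dots,d-1\}$, $\Sigma^*=\bigcup_{n\ge0}\Sigma^n$ the set of all finite words over $\Sigma$ (with empty word $\epsilon$), and $\Delta_n=\bigcup_{i=0}^n\Sigma^i$. A labeled tree is a function $t:\Sigma^*\to\mathcal{A}$, $w\mapsto t_w$. An $n$-block is a function $u:\Delta_n\to\mathcal{A}$; it appears in $t$ if there is $s\in\Sigma^*$ with $t_{sw}=u_w$ for all $w\in\Delta_n$. A tree-shift is a set of labeled trees consisting of all those avoiding (i.e. in which none appears) a certain set of forbidden blocks. For a tree-shift $\mathcal{T}$, $B_n(\mathcal{T})$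 is the set of $n$-blocks appearing in elements of $\mathcal{T}$ and $\mathcal{A}(\mathcal{T})$ is its alphabet. A chain is a sequence $\mathbf{s}=(s_i)_{i\in\mathbb{N}}$ in $\Sigma^*$ with $s_1=\epsilon$ and $s_{i+1}\in s_i\Sigma$ for all $i\ge1$; put $(\pi_{\mathbf{s}}t)_i=t_{s_i}$. The hom tree-shift of a shift space $X\subseteq\mathcal{A}^{\mathbb{N}}$ is $\mathcal{T}_X=\{t\in\mathcal{A}^{\Sigma^*}:\pi_{\mathbf{s}}(t)\in X\text{ for every chain }\mathbf{s}\}$. Two tree-shifts $\mathcal{T}$ and $\mathcal{S}$ are topologically conjugate if there is a one-to-one correspondence (bijection) $\psi:\mathcal{T}\to\mathcal{S}$ induced by a block map $\Psi:B_n(\mathcal{T})\to\mathcal{A}(\mathcal{S})$ for some $n\in\mathbb{N}$, i.e. $(\psi(t))_w=\Psi\big((t_{wv})_{v\in\Delta_n}\big)$ for all $t\in\mathcal{T}$, $w\in\Sigma^*$. *)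

theory Defs
  imports Main "HOL-Library.FuncSet"
begin

text \<open>One-sided sequences are functions on \<^typ>\<open>nat\<close>, so the index set
  \<open>{1, 2, \<dots>}\<close> of the mathematical text is shifted down by one throughout.\<close>

definition occurs_in :: "'a list \<Rightarrow> (nat \<Rightarrow> 'a) \<Rightarrow> bool" where
  "occurs_in w x \<longleftrightarrow> (\<exists>i. map x [i..<i + length w] = w)"

definition shift_avoiding :: "'a set \<Rightarrow> 'a list set \<Rightarrow> (nat \<Rightarrow> 'a) set" where
  "shift_avoiding A F = {x. range x \<subseteq> A \<and> (\<forall>w\<in>F. \<not> occurs_in w x)}"

definition shift_of_finite_type :: "'a set \<Rightarrow> (nat \<Rightarrow> 'a) set \<Rightarrow> bool" where
  "shift_of_finite_type A X \<longleftrightarrow>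
     finite A \<and> (\<exists>F. finite F \<and> F \<subseteq> lists A \<and> X = shift_avoiding A F)"

definition alphabet :: "(nat \<Rightarrow> 'a) set \<Rightarrow> 'a set" where
  "alphabet X = (\<Union>x\<in>X. range x)"

definition higher_block_shift :: "nat \<Rightarrow> (nat \<Rightarrow> 'a) set \<Rightarrow> (nat \<Rightarrow> 'a list) set" where
  "higher_block_shift n X =
     {y. (\<forall>i. y i \<in> lists (alphabet X) \<and> length (y i) = n) \<and>
         (\<exists>x\<in>X. \<forall>i. y i = map x [i..<i + n])}"

text \<open>Functions on the sets \<open>nodes d\<close> and \<open>\<Delta> d n\<close> are represented by extensional functions
  (value \<^term>\<open>undefined\<close> outside the domain), so that equality of such functions
  is equality on the domain.\<close>

definition nodes :: "nat \<Rightarrow> nat list set" where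
  "nodes d = lists {..<d}"

definition \<Delta> :: "nat \<Rightarrow> nat \<Rightarrow> nat list set" where
  "\<Delta> d n = {w \<in> nodes d. length w \<le> n}"

definition chain :: "nat \<Rightarrow> (nat \<Rightarrow> nat list) \<Rightarrow> bool" where
  "chain d s \<longleftrightarrow> s 0 = [] \<and> (\<forall>i. \<exists>a<d. s (Suc i) = s i @ [a])"

text \<open>Every node lies on a chain when \<open>d \<ge> 1\<close>, so replacing \<open>alphabet X\<close> below by a larger
  ambient alphabet would not change the set.\<close>

definition hom_tree_shift :: "nat \<Rightarrow> (nat \<Rightarrow> 'a) set \<Rightarrow> (nat list \<Rightarrow> 'a) set" where
  "hom_tree_shift d X =
     {t \<in> nodes d \<rightarrow>\<^sub>E alphabet X. \<forall>s. chain d s \<longrightarrow> (\<lambda>i. t (s i)) \<in> X}"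

definition tree_alphabet :: "nat \<Rightarrow> (nat list \<Rightarrow> 'a) set \<Rightarrow> 'a set" where
  "tree_alphabet d T = (\<Union>t\<in>T. t ` nodes d)"

definition appears_in :: "nat \<Rightarrow> nat \<Rightarrow> (nat list \<Rightarrow> 'a) \<Rightarrow> (nat list \<Rightarrow> 'a) \<Rightarrow> bool" where
  "appears_in d n u t \<longleftrightarrow> (\<exists>s\<in>nodes d. \<forall>w\<in>\<Delta> d n. t (s @ w) = u w)"

definition blocks :: "nat \<Rightarrow> nat \<Rightarrow> (nat list \<Rightarrow> 'a) set \<Rightarrow> (nat list \<Rightarrow> 'a) set" where
  "blocks d n T = {u \<in> \<Delta> d n \<rightarrow>\<^sub>E tree_alphabet d T. \<exists>t\<in>T. appears_in d n u t}"

definition topologically_conjugate ::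
  "nat \<Rightarrow> (nat list \<Rightarrow> 'a) set \<Rightarrow> (nat list \<Rightarrow> 'b) set \<Rightarrow> bool" where
  "topologically_conjugate d T S \<longleftrightarrow>
     (\<exists>\<psi> n \<Psi>. bij_betw \<psi> T S \<and> n \<ge> 1 \<and> \<Psi> \<in> blocks d n T \<rightarrow> tree_alphabet d S \<and>
        (\<forall>t\<in>T. \<forall>w\<in>nodes d. \<psi> t w = \<Psi> (\<lambda>v\<in>\<Delta> d n. t (w @ v))))"

end

theory Submission
  imports Defs
begin

text \<open>The full shift on two symbols already separates \<open>T\<^sub>X\<close> from \<open>T\<^bsub>X[2]\<^esub>\<close>. The invariant is
  whether arbitrary trees can be hung together under a common root. In the hom tree-shift of a
  full shift every labeling is allowed, so any \<open>d\<close> trees are the subtrees below the root of some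
  element (\<open>hom_tree_shift_full_shift\<close>). In the hom tree-shift of a higher block shift with
  \<open>m \<ge> 2\<close>, the word at a node overlaps the word at each of its children in \<open>m - 1 \<ge> 1\<close> letters,
  so the children of the root begin with the same letter (\<open>children_labels_overlap_root\<close>).

  A map given by a block map commutes with passing to subtrees. Suppose that such a map reaches
  the two constant trees with labels \<open>a\<dots>a\<close> and \<open>b\<dots>b\<close>, where \<open>a \<noteq> b\<close>. Hanging preimages of
  these trees below one root gives a tree whose image has children labeled \<open>a\<dots>a\<close> and \<open>b\<dots>b\<close>,
  which the overlap forbids. Hence not even a surjective block map exists from the first
  tree-shift to the second.\<close>

lemma chain_in_nodes:
  assumes "chain d s"
  shows "s i \<in> nodes d"
proof (induction i)
  case 0
  then show ?case using assms by (simp add: chain_def nodes_def)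
next
  case (Suc i)
  obtain c where "c < d" "s (Suc i) = s i @ [c]"
    using assms by (auto simp: chain_def)
  with Suc show ?case by (simp add: nodes_def)
qed

lemma chain_replicate:
  assumes "c < d"
  shows "chain d (\<lambda>i. replicate i c)"
  using assms by (auto simp: chain_def replicate_append_same)

lemma alphabet_full_shift: "alphabet (shift_avoiding A {}) = A"
proof
  show "A \<subseteq> alphabet (shift_avoiding A {})"
  proof
    fix a assume "a \<in> A"
    then have "(\<lambda>_. a) \<in> shift_avoiding A {}"
      by (simp add: shift_avoiding_def)
    then show "a \<in> alphabet (shift_avoiding A {})"
      by (force simp: alphabet_def)
  qed
qed (auto simp: alphabet_def shift_avoiding_def)

lemma hom_tree_shift_full_shift:
  "hom_tree_shift d (shift_avoiding A {}) = nodes d \<rightarrow>\<^sub>E A"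
  unfolding hom_tree_shift_def alphabet_full_shift
  using chain_in_nodes by (fastforce simp: shift_avoiding_def)

lemma constant_tree_in_hom_tree_shift:
  assumes "(\<lambda>_. a) \<in> X"
  shows "(\<lambda>w\<in>nodes d. a) \<in> hom_tree_shift d X"
proof -
  have "a \<in> alphabet X"
    using assms by (force simp: alphabet_def)
  then show ?thesis
    using assms by (simp add: hom_tree_shift_def chain_in_nodes)
qed

lemma constant_in_higher_block_shift:
  assumes "(\<lambda>_. a) \<in> X"
  shows "(\<lambda>_. replicate m a) \<in> higher_block_shift m X"
proof -
  have "a \<in> alphabet X"
    using assms by (force simp: alphabet_def)
  moreover have "\<forall>i. replicate m a = map (\<lambda>_. a) [i..<i + m]"
    by (simp add: map_replicate_const)
  ultimately show ?thesis
    using assms unfolding higher_block_shift_def by (auto intro!: bexI[of _ "\<lambda>_. a"])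
qed

text \<open>Two consecutive windows of width \<open>m\<close> share \<open>m - 1\<close> letters. Only the first step of the chain
  matters, so it may repeat the letter \<open>c\<close> forever. The right-hand side does not depend on \<open>c\<close>:
  this is what ties the children of the root to one another.\<close>

lemma children_labels_overlap_root:
  assumes t: "t \<in> hom_tree_shift d (higher_block_shift m X)" and "c < d"
  shows "butlast (t [c]) = tl (t [])"
proof -
  have "(\<lambda>i. t (replicate i c)) \<in> higher_block_shift m X"
    using t chain_replicate[OF \<open>c < d\<close>] by (auto simp: hom_tree_shift_def)
  then obtain x where x: "\<And>i. t (replicate i c) = map x [i..<i + m]"
    by (auto simp: higher_block_shift_def)
  show ?thesis
    using x[of 0] x[of 1] by (simp add: map_butlast[symmetric] map_tl[symmetric])
qed

text \<open>Through a block map, the root label of the image of a subtree can be read off at the node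
  where the subtree is attached, whatever the rest of the tree is.\<close>

lemma block_map_label_at_subtree:
  assumes block_map: "\<And>t w. t \<in> T \<Longrightarrow> w \<in> nodes d \<Longrightarrow> \<psi> t w = \<Psi> (\<lambda>v\<in>\<Delta> d n. t (w @ v))"
    and "t \<in> T" "p \<in> T" "w \<in> nodes d"
    and subtree: "\<And>v. v \<in> nodes d \<Longrightarrow> t (w @ v) = p v"
  shows "\<psi> t w = \<psi> p []"
proof -
  have "(\<lambda>v\<in>\<Delta> d n. t (w @ v)) = (\<lambda>v\<in>\<Delta> d n. p ([] @ v))"
    by (rule restrict_ext) (simp add: \<Delta>_def subtree)
  moreover have "[] \<in> nodes d"
    by (simp add: nodes_def)
  ultimately show ?thesis
    using block_map[OF \<open>t \<in> T\<close> \<open>w \<in> nodes d\<close>] block_map[OF \<open>p \<in> T\<close>] by simp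
qed

theorem full_shift_not_conjugate_higher_block:
  assumes "d \<ge> 2" "m \<ge> 2" "a \<in> A" "b \<in> A" "a \<noteq> b"
  shows "\<not> topologically_conjugate d (hom_tree_shift d (shift_avoiding A {}))
           (hom_tree_shift d (higher_block_shift m (shift_avoiding A {})))"
    (is "\<not> topologically_conjugate d ?T ?S")
proof
  assume "topologically_conjugate d ?T ?S"
  then obtain \<psi> n \<Psi> where bij: "bij_betw \<psi> ?T ?S"
    and block_map: "\<And>t w. t \<in> ?T \<Longrightarrow> w \<in> nodes d \<Longrightarrow> \<psi> t w = \<Psi> (\<lambda>v\<in>\<Delta> d n. t (w @ v))"
    unfolding topologically_conjugate_def by blast
  have preimage: "\<exists>p\<in>?T. \<psi> p [] = replicate m e" if "e \<in> A" for e
  proof -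
    have "(\<lambda>_. e) \<in> shift_avoiding A {}"
      using that by (simp add: shift_avoiding_def)
    then have "(\<lambda>w\<in>nodes d. replicate m e) \<in> ?S"
      by (intro constant_tree_in_hom_tree_shift constant_in_higher_block_shift)
    then obtain p where "p \<in> ?T" "\<psi> p = (\<lambda>w\<in>nodes d. replicate m e)"
      using bij unfolding bij_betw_def by (metis (no_types, lifting) imageE)
    then show ?thesis by (force simp: nodes_def)
  qed
  obtain p q where p: "p \<in> ?T" "\<psi> p [] = replicate m a" and q: "q \<in> ?T" "\<psi> q [] = replicate m b"
    using preimage assms by blast
  \<comment> \<open>The subtree \<open>p\<close> sits below the letter \<open>0\<close> and \<open>q\<close> below every other letter; the root
     label is arbitrary.\<close>
  define t where "t = (\<lambda>w\<in>nodes d. case w of [] \<Rightarrow> a | c # v \<Rightarrow> (if c = 0 then p v else q v))"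
  have t: "t \<in> ?T"
    using p(1) q(1) assms
    by (auto simp: hom_tree_shift_full_shift t_def PiE_iff nodes_def split: list.split)
  have "\<psi> t [0] = \<psi> p []"
    by (rule block_map_label_at_subtree[where T = ?T and \<psi> = \<psi> and \<Psi> = \<Psi> and n = n and d = d, OF block_map t p(1)])
      (use assms in \<open>auto simp: t_def nodes_def\<close>)
  moreover have "\<psi> t [1] = \<psi> q []"
    by (rule block_map_label_at_subtree[where T = ?T and \<psi> = \<psi> and \<Psi> = \<Psi> and n = n and d = d, OF block_map t q(1)])
      (use assms in \<open>auto simp: t_def nodes_def\<close>)
  moreover have "\<psi> t \<in> ?S"
    using bij t by (auto simp: bij_betw_def)
  then have "butlast (\<psi> t [0]) = butlast (\<psi> t [1])"
    using assms children_labels_overlap_root[of "\<psi> t" d m] by simp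
  ultimately have "replicate (m - 1) a = replicate (m - 1) b"
    using p(2) q(2) by (simp add: butlast_conv_take)
  then show False
    using assms by simp
qed

theorem proposition3p4:
  fixes d :: nat
  assumes "d \<ge> 2"
  shows "\<exists>(A :: nat set) (X :: (nat \<Rightarrow> nat) set) (m :: nat).
    shift_of_finite_type A X \<and> m \<ge> 1 \<and>
    \<not> topologically_conjugate d (hom_tree_shift d X) (hom_tree_shift d (higher_block_shift m X))"
proof (intro exI conjI)
  show "shift_of_finite_type {0, 1} (shift_avoiding {0, 1 :: nat} {})"
    unfolding shift_of_finite_type_def by (intro conjI exI[of _ "{}"]) auto
  show "\<not> topologically_conjugate d (hom_tree_shift d (shift_avoiding {0, 1 :: nat} {}))
          (hom_tree_shift d (higher_block_shift 2 (shift_avoiding {0, 1 :: nat} {})))"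
    by (rule full_shift_not_conjugate_higher_block[OF assms, of 2 0 _ 1]) simp_all
qed simp

end
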